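(* The one-sided transposition shuffle $P_n$ exhibits a (total variation) cutoff at time $n\log n$. Specifically, for any $c_1>0$ and any $c_2>2$, $$\limsup_{n\to\infty}\,\lVert P_n^{\,n\log n+c_1 n}-\pi_n\rVert_{\mathrm{TV}}\;\le\;\sqrt2\,e^{-c_1},$$ and $$\liminf_{n\to\infty}\,\lVert P_n^{\,n\log n-n\log\log n-c_2 n}-\pi_n\rVert_{\mathrm{TV}}\;\ge\;1-\frac{\pi^2}{6(c_2-2)^2}.$$
   Context: For $n\ge1$, $P_n$ is the probability distribution on the symmetric group $S_n$ given by $P_n(\tau)=\frac1n\cdot\frac1j$ if $\tau=(i\,j)$ is the transposition with $1\le i<j\le n$, $P_n(\mathrm{id})=\frac1n\left(1+\frac12+\dots+\frac1n\right)$, and $P_n(\tau)=0$ otherwise. (Equivalently: choose $j$ uniformly in $\{1,\dots,n\}$, then $i$ uniformly in $\{1,\dots,j\}$, and apply $(i\,j)$, with $(i\,i)=\mathrm{id}$.) $P_n^t$ is the $t$-fold convolution of $P_n$ with itself. $\pi_n$ is the uniform distribution on $S_n$. Total variation distance: $\lVert P-Q\rVert_{\mathrm{TV}}=\frac12\sum_{\sigma\in S_n}|P(\sigma)-Q(\sigma)|$. Times in exponents that are not integers are rounded down to an integer. Cutoff: a sequence of distributions $\{Q_n\}$ on $S_n$ with stationary distributions $\pi_n$ exhibits a (total variation) cutoff at time $\{t_n\}$ with a window of size $\{w_n\}$ if $w_n=o(t_n)$, $\lim_{c\to\infty}\limsup_{n\to\infty}\lVert Q_n^{t_n+cw_n}-\pi_n\rVert_{\mathrm{TV}}=0$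 and $\lim_{c\to\infty}\liminf_{n\to\infty}\lVert Q_n^{t_n-cw_n}-\pi_n\rVert_{\mathrm{TV}}=1$. It exhibits a cutoff at time $\{t_n\}$ if this holds for some window $\{w_n\}$ with $w_n=o(t_n)$. Here $\pi^2$ in the lower bound is the square of the number $\pi=3.14\ldots$. *)

theory Defs
  imports
    "HOL-Probability.Probability"
    "HOL-Combinatorics.Permutations"
    "HOL-Library.Landau_Symbols"
begin

abbreviation sym_group :: "nat \<Rightarrow> (nat \<Rightarrow> nat) set" where
  "sym_group n \<equiv> {\<sigma>. \<sigma> permutes {1..n}}"

definition is_transp :: "nat \<Rightarrow> (nat \<Rightarrow> nat) \<Rightarrow> nat \<Rightarrow> nat \<Rightarrow> bool" where
  "is_transp n \<tau> i j \<longleftrightarrow> 1 \<le> i \<and> i < j \<and> j \<le> n \<and> \<tau> = Transposition.transpose i j"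

text \<open>The weight of a transposition depends only on its larger entry \<open>j\<close>,
  which is determined by the transposition; see \<open>one_sided_mass_transp\<close>.\<close>

definition one_sided_mass :: "nat \<Rightarrow> (nat \<Rightarrow> nat) \<Rightarrow> real" where
  "one_sided_mass n \<tau> =
     (if \<exists>i j. is_transp n \<tau> i j
        then 1 / real n * (1 / real (THE j. \<exists>i. is_transp n \<tau> i j))
      else if \<tau> = id then 1 / real n * (\<Sum>k=1..n. 1 / real k)
      else 0)"

text \<open>For \<open>n = 0\<close> the mass function is identically zero and the value below is
  unspecified; all statements concern \<open>n \<ge> 1\<close>.\<close>

definition one_sided_shuffle :: "nat \<Rightarrow> (nat \<Rightarrow> nat) pmf" where
  "one_sided_shuffle n = embed_pmf (one_sided_mass n)"

definition uniform_perm :: "nat \<Rightarrow> (nat \<Rightarrow> nat) pmf" where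
  "uniform_perm n = pmf_of_set (sym_group n)"

definition convolve :: "('a \<Rightarrow> 'a) pmf \<Rightarrow> ('a \<Rightarrow> 'a) pmf \<Rightarrow> ('a \<Rightarrow> 'a) pmf" where
  "convolve p q = map_pmf (\<lambda>(\<tau>, \<sigma>). \<tau> \<circ> \<sigma>) (pair_pmf p q)"

primrec conv_power :: "('a \<Rightarrow> 'a) pmf \<Rightarrow> nat \<Rightarrow> ('a \<Rightarrow> 'a) pmf" where
  "conv_power p 0 = return_pmf id"
| "conv_power p (Suc t) = convolve p (conv_power p t)"

definition tv_dist :: "nat \<Rightarrow> (nat \<Rightarrow> nat) pmf \<Rightarrow> (nat \<Rightarrow> nat) pmf \<Rightarrow> real" where
  "tv_dist n p q = 1 / 2 * (\<Sum>\<sigma>\<in>sym_group n. \<bar>pmf p \<sigma> - pmf q \<sigma>\<bar>)"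

text \<open>Distance to uniformity at a real time \<open>t\<close>, rounded down.  Negative times are
  read as \<open>0\<close>; for each fixed \<open>c\<close> they occur only for finitely many \<open>n\<close> in
  the limits below, as long as the sequence of cutoff times is eventually positive.\<close>

definition dist_at :: "(nat \<Rightarrow> (nat \<Rightarrow> nat) pmf) \<Rightarrow> nat \<Rightarrow> real \<Rightarrow> real" where
  "dist_at Q n t = tv_dist n (conv_power (Q n) (nat \<lfloor>t\<rfloor>)) (uniform_perm n)"

definition cutoff_window ::
    "(nat \<Rightarrow> (nat \<Rightarrow> nat) pmf) \<Rightarrow> (nat \<Rightarrow> real) \<Rightarrow> (nat \<Rightarrow> real) \<Rightarrow> bool" where
  "cutoff_window Q t w \<longleftrightarrow>
     (\<forall>n\<ge>1. set_pmf (Q n) \<subseteq> sym_group n) \<and>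
     w \<in> o(t) \<and>
     ((\<lambda>c::real. limsup (\<lambda>n. ereal (dist_at Q n (t n + c * w n)))) \<longlongrightarrow> 0) at_top \<and>
     ((\<lambda>c::real. liminf (\<lambda>n. ereal (dist_at Q n (t n - c * w n)))) \<longlongrightarrow> 1) at_top"

definition cutoff :: "(nat \<Rightarrow> (nat \<Rightarrow> nat) pmf) \<Rightarrow> (nat \<Rightarrow> real) \<Rightarrow> bool" where
  "cutoff Q t \<longleftrightarrow> (\<exists>w. cutoff_window Q t w)"

lemma is_transp_unique:
  assumes "is_transp n \<tau> i j" "is_transp n \<tau> k l"
  shows "i = k" "j = l"
proof -
  have a: "i < j" "k < l" "Transposition.transpose i j = Transposition.transpose k l"
    using assms by (auto simp: is_transp_def)
  from fun_cong[OF a(3), of i] fun_cong[OF a(3), of j] a(1,2)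
  show "i = k" "j = l" by (auto simp: Transposition.transpose_def split: if_splits)
qed

lemma is_transp_neq_id: "\<not> is_transp n id i j"
  using transpose_eq_id_iff[of i j] by (metis is_transp_def less_irrefl)

lemma one_sided_mass_transp:
  assumes "1 \<le> i" "i < j" "j \<le> n"
  shows "one_sided_mass n (Transposition.transpose i j) = 1 / real n * (1 / real j)"
proof -
  have t: "is_transp n (Transposition.transpose i j) i j"
    using assms by (simp add: is_transp_def)
  then have "(THE j'. \<exists>i'. is_transp n (Transposition.transpose i j) i' j') = j"
    using is_transp_unique by (intro the_equality) blast+
  with t show ?thesis by (auto simp: one_sided_mass_def)
qed

lemma one_sided_mass_id:
  "one_sided_mass n id = 1 / real n * (\<Sum>k=1..n. 1 / real k)"
  by (simp add: one_sided_mass_def is_transp_neq_id)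

definition one_sided_step :: "nat \<Rightarrow> (nat \<Rightarrow> nat) pmf" where
  "one_sided_step n = pmf_of_set {1..n} \<bind>
     (\<lambda>j. map_pmf (\<lambda>i. Transposition.transpose i j) (pmf_of_set {1..j}))"

lemma transp_fibre:
  assumes "j \<in> {1..n}"
  shows "{i\<in>{1..j}. Transposition.transpose i j = \<tau>} =
    (if \<tau> = id then {j} else {i. is_transp n \<tau> i j})" (is "?L = ?R")
proof (rule set_eqI)
  fix i
  have "i \<in> ?L \<longleftrightarrow> 1 \<le> i \<and> i \<le> j \<and> Transposition.transpose i j = \<tau>"
    by simp
  also have "\<dots> \<longleftrightarrow> i \<in> ?R"
  proof (cases "\<tau> = id")
    case True
    then show ?thesis using assms transpose_eq_id_iff[of i j] by auto
  next
    case False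
    then have "i < j" if "Transposition.transpose i j = \<tau>" "i \<le> j"
      using that transpose_eq_id_iff[of i j] by (cases "i = j") auto
    with False assms show ?thesis unfolding is_transp_def by (simp, metis less_imp_le)
  qed
  finally show "i \<in> ?L \<longleftrightarrow> i \<in> ?R" .
qed

lemma pmf_one_sided_step:
  assumes "n \<ge> 1"
  shows "pmf (one_sided_step n) \<tau> = one_sided_mass n \<tau>"
proof -
  let ?A = "\<lambda>j. {i\<in>{1..j}. Transposition.transpose i j = \<tau>}"
  let ?q = "\<lambda>j. map_pmf (\<lambda>i. Transposition.transpose i j) (pmf_of_set {1..j})"
  have "pmf (one_sided_step n) \<tau> = (\<Sum>j\<in>{1..n}. pmf (?q j) \<tau>) / real (card {1..n})"
    unfolding one_sided_step_def
    by (rule pmf_bind_pmf_of_set) (use assms in simp_all)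
  also have "(\<Sum>j\<in>{1..n}. pmf (?q j) \<tau>) = (\<Sum>j\<in>{1..n}. real (card (?A j)) / real j)"
  proof (rule sum.cong[OF refl])
    fix j assume "j \<in> {1..n}"
    then have j: "{1..j} \<noteq> {}" by simp
    have eq: "{1..j} \<inter> (\<lambda>i. Transposition.transpose i j) -` {\<tau>} = ?A j" by blast
    show "pmf (?q j) \<tau> = real (card (?A j)) / real j"
      by (simp only: pmf_map measure_pmf_of_set[OF j finite_atLeastAtMost] eq card_atLeastAtMost) simp
  qed
  also have "(\<Sum>j\<in>{1..n}. real (card (?A j)) / real j) / real (card {1..n}) = one_sided_mass n \<tau>"
  proof (cases "\<tau> = id")
    case True
    have "(\<Sum>j\<in>{1..n}. real (card (?A j)) / real j) = (\<Sum>j\<in>{1..n}. 1 / real j)"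
      by (rule sum.cong[OF refl]) (simp only: transp_fibre True, simp)
    then show ?thesis using one_sided_mass_id[of n] True by simp
  next
    case \<tau>: False
    have A: "(\<Sum>j\<in>{1..n}. real (card (?A j)) / real j)
        = (\<Sum>j\<in>{1..n}. real (card {i. is_transp n \<tau> i j}) / real j)"
      by (rule sum.cong[OF refl]) (simp only: transp_fibre \<tau> if_False)
    show ?thesis
    proof (cases "\<exists>i j. is_transp n \<tau> i j")
      case True
      then obtain a b where ab: "is_transp n \<tau> a b" by blast
      then have b: "b \<in> {1..n}" and mass: "one_sided_mass n \<tau> = 1 / real n * (1 / real b)"
        using one_sided_mass_transp[of a b n] by (simp_all add: is_transp_def)
      have "{i. is_transp n \<tau> i j} = (if j = b then {a} else {})" for j
      proof (cases "j = b")
        case True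
        have "is_transp n \<tau> i b \<longleftrightarrow> i = a" for i
          using ab is_transp_unique(1)[OF ab, of i b] by metis
        then show ?thesis by (simp add: True)
      next
        case False
        have "\<not> is_transp n \<tau> i j" for i
          using False is_transp_unique(2)[OF ab, of i j] by metis
        then show ?thesis by (simp add: False)
      qed
      then have "(\<Sum>j\<in>{1..n}. real (card (?A j)) / real j)
          = (\<Sum>j\<in>{1..n}. if j = b then 1 / real j else 0)"
        unfolding A by (intro sum.cong[OF refl]) simp
      also have "\<dots> = 1 / real b" using b by simp
      finally show ?thesis by (simp add: mass)
    next
      case False
      then show ?thesis unfolding A using \<tau> by (simp add: one_sided_mass_def)
    qed
  qed
  finally show ?thesis .
qed

lemma one_sided_shuffle_eq_step:
  assumes "n \<ge> 1"
  shows "one_sided_shuffle n = one_sided_step n"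
proof -
  have "one_sided_mass n = pmf (one_sided_step n)"
    using pmf_one_sided_step[OF assms] by auto
  then show ?thesis
    unfolding one_sided_shuffle_def
    by (simp add: type_definition.Rep_inverse[OF td_pmf_embed_pmf])
qed

lemma pmf_one_sided_shuffle:
  assumes "n \<ge> 1"
  shows "pmf (one_sided_shuffle n) \<tau> = one_sided_mass n \<tau>"
  using assms by (simp add: one_sided_shuffle_eq_step pmf_one_sided_step)

lemma pmf_convolve:
  assumes "set_pmf p \<subseteq> sym_group n" "set_pmf q \<subseteq> sym_group n"
  shows "pmf (convolve p q) \<sigma> = (\<Sum>\<tau>\<in>sym_group n. pmf p \<tau> * pmf q (inv \<tau> \<circ> \<sigma>))"
proof -
  have fin: "finite (sym_group n)" by (simp add: finite_permutations)
  have "convolve p q = p \<bind> (\<lambda>\<tau>. map_pmf ((\<circ>) \<tau>) q)"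
    by (simp add: convolve_def pair_pmf_def map_pmf_def bind_assoc_pmf bind_return_pmf)
  then have "pmf (convolve p q) \<sigma> = (\<Sum>\<tau>\<in>sym_group n. pmf p \<tau> * pmf (map_pmf ((\<circ>) \<tau>) q) \<sigma>)"
    using fin assms(1) by (simp add: pmf_bind integral_measure_pmf[where A = "sym_group n"] subset_iff)
  also have "\<dots> = (\<Sum>\<tau>\<in>sym_group n. pmf p \<tau> * pmf q (inv \<tau> \<circ> \<sigma>))"
  proof (rule sum.cong)
    fix \<tau> assume "\<tau> \<in> sym_group n"
    then have b: "bij \<tau>" by (auto intro: permutes_bij)
    then have "inj ((\<circ>) \<tau>)" by (auto simp: inj_def fun_eq_iff bij_def)
    moreover have "\<tau> \<circ> (inv \<tau> \<circ> \<sigma>) = \<sigma>"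
      using b by (auto simp: fun_eq_iff bij_def surj_f_inv_f)
    ultimately show "pmf p \<tau> * pmf (map_pmf ((\<circ>) \<tau>) q) \<sigma> = pmf p \<tau> * pmf q (inv \<tau> \<circ> \<sigma>)"
      using pmf_map_inj'[of "(\<circ>) \<tau>" q "inv \<tau> \<circ> \<sigma>"] by metis
  qed simp
  finally show ?thesis .
qed

end

theory Submission
  imports Defs "HOL-Real_Asymp.Real_Asymp"
begin

text \<open>Write \<open>A\<^sub>j\<close> for the distribution of \<open>(i j)\<close> with \<open>i\<close> uniform in \<open>{1..j}\<close>, so that
  one step of the shuffle is the average of \<open>A\<^sub>1, \<dots>, A\<^sub>n\<close>.  Both bounds come from comparison
  with the coupon collector that records which positions have been drawn.

  Upper bound.  In the group algebra \<open>A\<^sub>j\<close> is \<open>(1 + J\<^sub>j) / j\<close> for the Jucys--Murphy element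
  \<open>J\<^sub>j\<close>, the sum of the transpositions \<open>(i j)\<close> with \<open>i < j\<close>; these elements commute
  (\<open>swap_below_commute\<close>).  The product of \<open>A\<^sub>1, \<dots>, A\<^sub>n\<close>, each taken once, is the
  Fisher--Yates shuffle and hence exactly uniform, and multiplying the uniform distribution by
  further factors changes nothing.  Therefore, conditionally on the sequence of values \<open>j\<close>, the walk
  is exactly uniform as soon as all of \<open>1, \<dots>, n\<close> have occurred, in whatever order
  (\<open>left_invariant_swaps_below\<close>).  The distance after \<open>t\<close> steps is thus at most the
  probability that the coupon collector has not finished, which is at most \<open>n (1 - 1/n)\<^sup>t\<close>
  (\<open>tv_dist_one_sided_le\<close>); at time \<open>n log n + c n\<close> this tends to \<open>e\<^sup>-\<^sup>c\<close>.

  Lower bound.  A position that never occurs in a transposition is a fixed point.  Consider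
  the top \<open>n / log n\<close> positions.  A uniform permutation has a fixed point among them with
  probability at most \<open>1 / log n\<close>.  In the walk a top position \<open>k\<close> is hit with probability at most
  \<open>1 / k\<close> per step, hardly more than \<open>1 / n\<close>, so at time \<open>n log n - n log log n - c n\<close> the expected
  number of positions not yet hit is asymptotically at least \<open>e\<^sup>c\<^sup>-\<^sup>1\<close>.  Two positions are
  avoided almost independently, and the second moment method shows that some top position is
  still a fixed point with limiting probability at least \<open>1 / (1 + e\<^sup>1\<^sup>-\<^sup>c)\<close>
  (\<open>tv_dist_one_sided_ge\<close>, \<open>liminf_dist_at_ge\<close>), which exceeds the stated bound.

  Both estimates hold with \<open>c\<close> growing like \<open>log log n\<close>, so \<open>n log log n\<close> serves as a cutoff
  window.\<close>

section \<open>Commuting factors of the shuffle\<close>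

definition swap_below :: "nat \<Rightarrow> (nat \<Rightarrow> nat) pmf" where
  "swap_below j = map_pmf (\<lambda>i. Transposition.transpose i j) (pmf_of_set {1..j})"

lemma one_sided_shuffle_eq_bind:
  assumes "n \<ge> 1"
  shows "one_sided_shuffle n = pmf_of_set {1..n} \<bind> swap_below"
  using one_sided_shuffle_eq_step[OF assms]
  by (simp add: one_sided_step_def swap_below_def[abs_def])

lemma set_swap_below:
  assumes "1 \<le> j" "j \<le> n"
  shows "set_pmf (swap_below j) \<subseteq> sym_group n"
  using assms by (auto simp: swap_below_def intro!: permutes_swap_id)

lemma convolve_eq_bind: "convolve p q = p \<bind> (\<lambda>\<tau>. map_pmf ((\<circ>) \<tau>) q)"
  by (simp add: convolve_def pair_pmf_def map_pmf_def bind_assoc_pmf bind_return_pmf)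

lemma convolve_swap_below:
  "convolve (swap_below j) q
     = pmf_of_set {1..j} \<bind> (\<lambda>i. map_pmf ((\<circ>) (Transposition.transpose i j)) q)"
  by (simp add: convolve_eq_bind swap_below_def bind_map_pmf)

lemma convolve_bind: "convolve (M \<bind> f) q = M \<bind> (\<lambda>x. convolve (f x) q)"
  by (simp add: convolve_eq_bind bind_assoc_pmf)

lemma convolve_bind_right: "convolve p (M \<bind> f) = M \<bind> (\<lambda>x. convolve p (f x))"
  unfolding convolve_eq_bind map_bind_pmf by (rule bind_commute_pmf)

lemma set_convolve:
  assumes "set_pmf p \<subseteq> sym_group n" "set_pmf q \<subseteq> sym_group n"
  shows "set_pmf (convolve p q) \<subseteq> sym_group n"
  using assms by (auto simp: convolve_def intro!: permutes_compose)

lemma map_pmf_left_comp: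
  "map_pmf ((\<circ>) f) (map_pmf ((\<circ>) g) q) = map_pmf ((\<circ>) (f \<circ> g)) q"
  unfolding pmf.map_comp by (rule arg_cong[of _ _ "\<lambda>h. map_pmf h q"]) (simp add: fun_eq_iff)

lemma permutes_transpose_comp:
  assumes "\<tau> permutes S"
  shows "\<tau> \<circ> Transposition.transpose i k = Transposition.transpose (\<tau> i) (\<tau> k) \<circ> \<tau>"
proof -
  have "inj \<tau>" using assms by (rule permutes_inj)
  then show ?thesis
    by (auto simp: fun_eq_iff Transposition.transpose_def dest: injD)
qed

lemma map_pmf_of_set_permutes:
  assumes "\<tau> permutes {1..k::nat}" "k \<ge> 1"
  shows "map_pmf \<tau> (pmf_of_set {1..k}) = pmf_of_set {1..k}"
  using assms by (intro map_pmf_of_set_bij_betw permutes_imp_bij) auto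

text \<open>Since \<open>\<tau>\<close> fixes \<open>k\<close>, conjugation by \<open>\<tau>\<close> turns \<open>(i k)\<close> into \<open>(\<tau> i k)\<close>, and \<open>\<tau> i\<close> is again
  uniform in \<open>{1..k}\<close>.\<close>

lemma swap_below_absorbs_permutation:
  assumes \<tau>: "\<tau> permutes {1..j}" and "j < k"
  shows "map_pmf ((\<circ>) \<tau>) (convolve (swap_below k) q)
    = convolve (swap_below k) (map_pmf ((\<circ>) \<tau>) q)"
proof -
  have \<tau>': "\<tau> permutes {1..k}"
    using \<tau> \<open>j < k\<close> by (auto intro: permutes_subset)
  have \<tau>k: "\<tau> k = k"
    using permutes_not_in[OF \<tau>] \<open>j < k\<close> by simp
  have comp: "map_pmf ((\<circ>) \<tau>) (map_pmf ((\<circ>) (Transposition.transpose i k)) q)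
      = map_pmf ((\<circ>) (Transposition.transpose (\<tau> i) k)) (map_pmf ((\<circ>) \<tau>) q)" for i
    by (simp only: map_pmf_left_comp permutes_transpose_comp[OF \<tau>] \<tau>k)
  have "map_pmf ((\<circ>) \<tau>) (convolve (swap_below k) q)
     = pmf_of_set {1..k} \<bind>
         (\<lambda>i. map_pmf ((\<circ>) (Transposition.transpose (\<tau> i) k)) (map_pmf ((\<circ>) \<tau>) q))"
    by (simp only: convolve_swap_below map_bind_pmf comp)
  also have "\<dots> = map_pmf \<tau> (pmf_of_set {1..k}) \<bind>
         (\<lambda>i. map_pmf ((\<circ>) (Transposition.transpose i k)) (map_pmf ((\<circ>) \<tau>) q))"
    by (simp only: bind_map_pmf)
  also have "map_pmf \<tau> (pmf_of_set {1..k}) = pmf_of_set {1..k}"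
    using \<tau>' \<open>j < k\<close> by (intro map_pmf_of_set_permutes) auto
  finally show ?thesis by (simp only: convolve_swap_below)
qed

lemma swap_below_commute_less:
  assumes "1 \<le> j" "j < k"
  shows "convolve (swap_below j) (convolve (swap_below k) q)
    = convolve (swap_below k) (convolve (swap_below j) q)"
proof -
  have "convolve (swap_below j) (convolve (swap_below k) q)
    = pmf_of_set {1..j} \<bind> (\<lambda>i. convolve (swap_below k)
         (map_pmf ((\<circ>) (Transposition.transpose i j)) q))"
    unfolding convolve_swap_below[of j]
    by (intro bind_pmf_cong refl swap_below_absorbs_permutation[of _ j] permutes_swap_id)
       (use assms in auto)
  then show ?thesis
    by (simp add: convolve_swap_below[of j] convolve_bind_right)
qed

text \<open>The commutation of Jucys--Murphy elements: for \<open>j < k\<close> every transposition in the support of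
  \<open>swap_below j\<close> fixes all points above \<open>j\<close>, so it can be moved past \<open>swap_below k\<close>.\<close>

lemma swap_below_commute:
  assumes "1 \<le> j" "1 \<le> k"
  shows "convolve (swap_below j) (convolve (swap_below k) q)
    = convolve (swap_below k) (convolve (swap_below j) q)"
  using swap_below_commute_less[of j k q] swap_below_commute_less[of k j q] assms
  by (cases j k rule: linorder_cases) auto

text \<open>The law of the walk conditionally on the values of \<open>j\<close> drawn in the successive steps; the
  first entry of the list belongs to the last step.\<close>

definition swaps_below :: "nat list \<Rightarrow> (nat \<Rightarrow> nat) pmf" where
  "swaps_below js = foldr (\<lambda>j. convolve (swap_below j)) js (return_pmf id)"

lemma swaps_below_simps:
  "swaps_below [] = return_pmf id"
  "swaps_below (j # js) = convolve (swap_below j) (swaps_below js)"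
  by (simp_all add: swaps_below_def)

lemma set_swaps_below:
  assumes "set js \<subseteq> {1..n}"
  shows "set_pmf (swaps_below js) \<subseteq> sym_group n"
  using assms
proof (induction js)
  case Nil
  then show ?case by (simp add: swaps_below_simps permutes_id)
next
  case (Cons j js)
  then show ?case unfolding swaps_below_simps
    by (intro set_convolve set_swap_below) auto
qed

lemma swaps_below_remove1:
  assumes "k \<in> set js" "0 \<notin> set js"
  shows "swaps_below js = convolve (swap_below k) (swaps_below (remove1 k js))"
  using assms
proof (induction js)
  case (Cons j js)
  then have "1 \<le> j" "1 \<le> k" by (auto intro!: Suc_leI gr0I)
  from swap_below_commute[OF this, of "swaps_below (remove1 k js)"] Cons show ?case
    by (cases "j = k") (simp_all add: swaps_below_simps)
qed simp

lemma conv_power_bind: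
  "conv_power (M \<bind> swap_below) t = replicate_pmf t M \<bind> swaps_below"
proof (induction t)
  case (Suc t)
  have "conv_power (M \<bind> swap_below) (Suc t)
      = M \<bind> (\<lambda>j. replicate_pmf t M \<bind> (\<lambda>js. swaps_below (j # js)))"
    unfolding conv_power.simps Suc convolve_bind_right convolve_bind swaps_below_simps
    by (rule bind_commute_pmf)
  then show ?case by (simp add: bind_assoc_pmf bind_return_pmf)
qed (simp add: bind_return_pmf swaps_below_simps)

section \<open>Collecting every position gives the uniform distribution\<close>

text \<open>Uniformity is reached in stages: invariance under left multiplication by the permutations of
  \<open>{1..m}\<close> is the form of partial uniformity that survives an induction on \<open>m\<close>.\<close>

definition left_invariant :: "nat \<Rightarrow> (nat \<Rightarrow> nat) pmf \<Rightarrow> bool" where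
  "left_invariant m q \<longleftrightarrow> (\<forall>\<tau>. \<tau> permutes {1..m} \<longrightarrow> map_pmf ((\<circ>) \<tau>) q = q)"

text \<open>The induction step behind the Fisher--Yates shuffle: the transpositions \<open>(i m+1)\<close> with
  \<open>i \<le> m+1\<close> represent the left cosets of the permutations of \<open>{1..m}\<close> in those of \<open>{1..m+1}\<close>.
  Left multiplication by \<open>\<tau>\<close> permutes these cosets through \<open>i \<mapsto> \<tau> i\<close>, and the remaining factor
  \<open>\<rho>\<close> is absorbed by the invariance of \<open>q\<close>.\<close>

lemma left_invariant_swap_below:
  assumes "left_invariant m q"
  shows "left_invariant (Suc m) (convolve (swap_below (Suc m)) q)"
  unfolding left_invariant_def
proof (intro allI impI)
  fix \<tau> assume \<tau>: "\<tau> permutes {1..Suc m}"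
  let ?k = "Suc m"
  let ?T = "\<lambda>i. Transposition.transpose i ?k"
  have step: "map_pmf ((\<circ>) \<tau>) (map_pmf ((\<circ>) (?T i)) q) = map_pmf ((\<circ>) (?T (\<tau> i))) q"
    if i: "i \<in> {1..?k}" for i
  proof -
    define \<rho> where "\<rho> = ?T (\<tau> i) \<circ> \<tau> \<circ> ?T i"
    have \<tau>i: "\<tau> i \<in> {1..?k}"
      using permutes_in_image[OF \<tau>] i by blast
    have "\<rho> permutes {1..?k}"
      unfolding \<rho>_def using i \<tau>i \<tau> by (intro permutes_compose permutes_swap_id) auto
    moreover have "\<rho> ?k = ?k" by (simp add: \<rho>_def)
    ultimately have "\<rho> permutes {1..m}"
      by (elim permutes_superset) (metis Diff_iff atLeastAtMost_iff le_Suc_eq)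
    then have \<rho>: "map_pmf ((\<circ>) \<rho>) q = q"
      using assms by (simp add: left_invariant_def)
    have "\<tau> \<circ> ?T i = ?T (\<tau> i) \<circ> \<rho>"
      by (simp add: \<rho>_def fun_eq_iff)
    then have "map_pmf ((\<circ>) \<tau>) (map_pmf ((\<circ>) (?T i)) q)
        = map_pmf ((\<circ>) (?T (\<tau> i))) (map_pmf ((\<circ>) \<rho>) q)"
      by (simp only: map_pmf_left_comp)
    with \<rho> show ?thesis by simp
  qed
  have "map_pmf ((\<circ>) \<tau>) (convolve (swap_below ?k) q)
      = pmf_of_set {1..?k} \<bind> (\<lambda>i. map_pmf ((\<circ>) (?T (\<tau> i))) q)"
    unfolding convolve_swap_below map_bind_pmf
    by (intro bind_pmf_cong refl step) simp
  also have "\<dots> = map_pmf \<tau> (pmf_of_set {1..?k}) \<bind> (\<lambda>i. map_pmf ((\<circ>) (?T i)) q)"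
    by (simp only: bind_map_pmf)
  also have "map_pmf \<tau> (pmf_of_set {1..?k}) = pmf_of_set {1..?k}"
    by (rule map_pmf_of_set_permutes[OF \<tau>]) simp
  finally show "map_pmf ((\<circ>) \<tau>) (convolve (swap_below ?k) q) = convolve (swap_below ?k) q"
    by (simp only: convolve_swap_below)
qed

text \<open>By commutativity the largest required factor \<open>m\<close> can be moved to the front; what remains still
  contains all smaller ones.\<close>

lemma left_invariant_swaps_below:
  assumes "{1..m} \<subseteq> set js" "0 \<notin> set js"
  shows "left_invariant m (swaps_below js)"
  using assms
proof (induction m arbitrary: js)
  case 0
  have "(\<circ>) id = (id :: (nat \<Rightarrow> nat) \<Rightarrow> _)" by (simp add: fun_eq_iff)
  then show ?case by (simp add: left_invariant_def)
next
  case (Suc m)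
  have "k \<in> set (remove1 (Suc m) js)" if "k \<in> {1..m}" for k
    using that Suc.prems(1) by (subst in_set_remove1) auto
  moreover have "0 \<notin> set (remove1 (Suc m) js)"
    using Suc.prems(2) set_remove1_subset by fastforce
  ultimately have "left_invariant m (swaps_below (remove1 (Suc m) js))"
    by (intro Suc.IH) auto
  moreover have "Suc m \<in> set js" using Suc.prems(1) by auto
  ultimately show ?case
    using left_invariant_swap_below swaps_below_remove1 Suc.prems(2) by metis
qed

lemma finite_sym_group: "finite (sym_group n)" and sym_group_not_empty: "sym_group n \<noteq> {}"
  by (auto simp: finite_permutations intro: permutes_id)

lemma card_sym_group: "card (sym_group n) = fact n"
  by (simp add: card_permutations)

lemma left_invariant_imp_uniform:
  assumes inv: "left_invariant n q" and supp: "set_pmf q \<subseteq> sym_group n"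
  shows "q = uniform_perm n"
proof (rule pmf_eqI)
  have const: "pmf q \<sigma> = pmf q id" if "\<sigma> permutes {1..n}" for \<sigma>
  proof -
    have "inj ((\<circ>) \<sigma> :: (nat \<Rightarrow> nat) \<Rightarrow> _)"
      using permutes_inj[OF that] by (auto simp: inj_def fun_eq_iff)
    then have "pmf (map_pmf ((\<circ>) \<sigma>) q) (\<sigma> \<circ> id) = pmf q id"
      by (rule pmf_map_inj')
    then show ?thesis using inv that by (simp add: left_invariant_def)
  qed
  have "1 = (\<Sum>\<sigma>\<in>sym_group n. pmf q \<sigma>)"
    using sum_pmf_eq_1[OF finite_sym_group supp] by simp
  also have "\<dots> = (\<Sum>\<sigma>\<in>sym_group n. pmf q id)"
    by (intro sum.cong refl const) simp
  also have "\<dots> = fact n * pmf q id"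
    by (simp only: sum_constant card_sym_group of_nat_fact)
  finally have id: "pmf q id = 1 / fact n" by (simp add: field_simps)
  fix \<sigma>
  show "pmf q \<sigma> = pmf (uniform_perm n) \<sigma>"
  proof (cases "\<sigma> \<in> sym_group n")
    case True
    then show ?thesis
      using const[of \<sigma>] id sym_group_not_empty[of n] finite_sym_group[of n] card_sym_group[of n]
      by (simp add: uniform_perm_def)
  next
    case False
    then have "pmf q \<sigma> = 0" using supp by (auto simp: set_pmf_iff)
    then show ?thesis using False sym_group_not_empty[of n] finite_sym_group[of n]
      by (simp add: uniform_perm_def)
  qed
qed

section \<open>Upper bound by coupon collecting\<close>

lemma set_uniform_perm: "set_pmf (uniform_perm n) = sym_group n"
  unfolding uniform_perm_def by (intro set_pmf_of_set sym_group_not_empty finite_sym_group)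

text \<open>If \<open>p\<close> contains a copy of \<open>q\<close> of mass \<open>1 - e\<close>, the two differ only by the remaining mass \<open>e\<close> on
  either side.\<close>

lemma tv_dist_le_of_domination:
  assumes supp: "set_pmf p \<subseteq> sym_group n" "set_pmf q \<subseteq> sym_group n" and "e \<ge> 0"
    and dom: "\<And>\<sigma>. \<sigma> \<in> sym_group n \<Longrightarrow> (1 - e) * pmf q \<sigma> \<le> pmf p \<sigma>"
  shows "tv_dist n p q \<le> e"
proof -
  have "(\<Sum>\<sigma>\<in>sym_group n. \<bar>pmf p \<sigma> - pmf q \<sigma>\<bar>)
      \<le> (\<Sum>\<sigma>\<in>sym_group n. pmf p \<sigma> - (1 - e) * pmf q \<sigma> + e * pmf q \<sigma>)"
  proof (rule sum_mono)
    fix \<sigma> assume "\<sigma> \<in> sym_group n"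
    from dom[OF this] show "\<bar>pmf p \<sigma> - pmf q \<sigma>\<bar> \<le> pmf p \<sigma> - (1 - e) * pmf q \<sigma> + e * pmf q \<sigma>"
      using mult_nonneg_nonneg[OF \<open>e \<ge> 0\<close> pmf_nonneg[of q \<sigma>]]
      by (simp add: algebra_simps abs_le_iff)
  qed
  also have "\<dots> = 2 * e"
    using sum_pmf_eq_1[OF finite_sym_group supp(1)] sum_pmf_eq_1[OF finite_sym_group supp(2)]
    by (simp add: sum.distrib sum_subtractf flip: sum_distrib_left)
  finally show ?thesis by (simp add: tv_dist_def)
qed

lemma prob_replicate_pmf_all:
  "measure_pmf.prob (replicate_pmf t q) {xs. set xs \<subseteq> A} = measure_pmf.prob q A ^ t"
proof (induction t)
  case (Suc t)
  have "emeasure (replicate_pmf (Suc t) q) {xs. set xs \<subseteq> A}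
    = (\<integral>\<^sup>+x. emeasure (replicate_pmf t q) {xs. set xs \<subseteq> A} * indicator A x \<partial>q)"
    by (simp add: emeasure_bind_pmf indicator_def flip: map_pmf_def cong: if_cong)
       (intro nn_integral_cong, auto simp: vimage_def)
  also have "\<dots> = emeasure (replicate_pmf t q) {xs. set xs \<subseteq> A} * emeasure q A"
    by (simp add: nn_integral_cmult)
  finally show ?case
    using Suc by (simp add: measure_pmf.emeasure_eq_measure flip: ennreal_mult)
qed (simp add: indicator_def)

lemma prob_coupons_missing:
  assumes "n \<ge> 1"
  shows "measure_pmf.prob (replicate_pmf t (pmf_of_set {1..n})) {js. \<not> {1..n} \<subseteq> set js}
    \<le> real n * (1 - 1 / real n) ^ t"
proof -
  let ?R = "replicate_pmf t (pmf_of_set {1..n})"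
  have one: "measure_pmf.prob ?R {js. set js \<subseteq> - {k}} = (1 - 1 / real n) ^ t"
    if "k \<in> {1..n}" for k
  proof -
    have "{1..n} \<inter> - {k} = {1..n} - {k}" by auto
    then have "measure_pmf.prob (pmf_of_set {1..n}) (- {k}) = 1 - 1 / real n"
      using assms that by (simp add: measure_pmf_of_set of_nat_diff field_simps)
    then show ?thesis by (simp only: prob_replicate_pmf_all)
  qed
  have "{js. \<not> {1..n} \<subseteq> set js} = (\<Union>k\<in>{1..n}. {js. set js \<subseteq> - {k}})" by auto
  also have "measure_pmf.prob ?R \<dots> \<le> (\<Sum>k\<in>{1..n}. measure_pmf.prob ?R {js. set js \<subseteq> - {k}})"
    by (intro measure_pmf.finite_measure_subadditive_finite) auto
  also have "\<dots> = real n * (1 - 1 / real n) ^ t"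
    using one by simp
  finally show ?thesis .
qed

lemma set_conv_power:
  assumes "set_pmf p \<subseteq> sym_group n"
  shows "set_pmf (conv_power p t) \<subseteq> sym_group n"
proof (induction t)
  case 0
  then show ?case by (simp add: permutes_id)
next
  case (Suc t)
  then show ?case using set_convolve[OF assms] by simp
qed

lemma set_one_sided_shuffle:
  assumes "n \<ge> 1"
  shows "set_pmf (one_sided_shuffle n) \<subseteq> sym_group n"
  using set_swap_below assms by (fastforce simp: one_sided_shuffle_eq_bind)

lemma tv_dist_one_sided_le:
  assumes n: "n \<ge> 1"
  shows "tv_dist n (conv_power (one_sided_shuffle n) t) (uniform_perm n)
    \<le> real n * (1 - 1 / real n) ^ t"
proof -
  define R where "R = replicate_pmf t (pmf_of_set {1..n})"
  define E where "E = {js. {1..n} \<subseteq> set js}"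
  have setR: "set js \<subseteq> {1..n}" if "js \<in> set_pmf R" for js
    using that n by (auto simp: R_def set_replicate_pmf)
  have eq: "conv_power (one_sided_shuffle n) t = R \<bind> swaps_below"
    using n by (simp add: one_sided_shuffle_eq_bind conv_power_bind R_def)
  have unif: "swaps_below js = uniform_perm n" if "js \<in> set_pmf R" "js \<in> E" for js
  proof (rule left_invariant_imp_uniform)
    show "left_invariant n (swaps_below js)"
      using that setR[of js] by (intro left_invariant_swaps_below) (auto simp: E_def)
    show "set_pmf (swaps_below js) \<subseteq> sym_group n"
      using that setR by (intro set_swaps_below)
  qed
  have dom: "measure_pmf.prob R E * pmf (uniform_perm n) \<sigma> \<le> pmf (R \<bind> swaps_below) \<sigma>" for \<sigma>
  proof -
    have "measure_pmf.prob R E * pmf (uniform_perm n) \<sigma>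
        = (\<integral>js. indicator E js * pmf (uniform_perm n) \<sigma> \<partial>R)"
      by simp
    also have "\<dots> \<le> (\<integral>js. pmf (swaps_below js) \<sigma> \<partial>R)"
    proof (rule integral_mono_AE)
      show "integrable R (\<lambda>js. indicator E js * pmf (uniform_perm n) \<sigma>)"
        by (rule measure_pmf.integrable_const_bound[where B = 1])
           (auto simp: indicator_def pmf_le_1)
      show "integrable R (\<lambda>js. pmf (swaps_below js) \<sigma>)"
        by (rule measure_pmf.integrable_const_bound[where B = 1]) (auto simp: pmf_le_1)
      show "AE js in R. indicator E js * pmf (uniform_perm n) \<sigma> \<le> pmf (swaps_below js) \<sigma>"
        by (auto simp: AE_measure_pmf_iff indicator_def unif)
    qed
    finally show ?thesis by (simp add: pmf_bind)
  qed
  have "tv_dist n (R \<bind> swaps_below) (uniform_perm n) \<le> 1 - measure_pmf.prob R E"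
  proof (rule tv_dist_le_of_domination)
    show "set_pmf (R \<bind> swaps_below) \<subseteq> sym_group n"
      using set_conv_power[OF set_one_sided_shuffle[OF n]] eq by metis
  qed (use dom in \<open>simp_all add: set_uniform_perm\<close>)
  also have "\<dots> = measure_pmf.prob R (- E)"
    using measure_pmf.prob_compl[of E R] by (simp add: Compl_eq_Diff_UNIV)
  also have "- E = {js. \<not> {1..n} \<subseteq> set js}" by (auto simp: E_def)
  also have "measure_pmf.prob R \<dots> \<le> real n * (1 - 1 / real n) ^ t"
    unfolding R_def by (rule prob_coupons_missing[OF n])
  finally show ?thesis by (simp add: eq)
qed

text \<open>The time is allowed to fall short by one unit to absorb rounding down.\<close>

lemma tv_dist_one_sided_le_exp:
  assumes n: "n \<ge> 1" and t: "real t \<ge> real n * ln (real n) + c * real n - 1"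
  shows "tv_dist n (conv_power (one_sided_shuffle n) t) (uniform_perm n)
    \<le> exp (1 / real n - c)"
proof -
  have "(1 - 1 / real n) ^ t \<le> exp (- (1 / real n)) ^ t"
    using n exp_ge_add_one_self[of "- (1 / real n)"] by (intro power_mono) auto
  also have "\<dots> = exp (- (real t / real n))"
    by (simp flip: exp_of_nat_mult)
  also have "real n * \<dots> = exp (ln (real n) - real t / real n)"
    using n by (simp add: exp_diff exp_minus divide_inverse)
  also have "\<dots> \<le> exp (1 / real n - c)"
  proof -
    have "(real n * ln (real n) + c * real n - 1) / real n \<le> real t / real n"
      using t by (intro divide_right_mono) auto
    then have "ln (real n) + c - 1 / real n \<le> real t / real n"
      using n by (simp add: add_divide_distrib diff_divide_distrib)
    then show ?thesis by simp
  qed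
  finally have "real n * (1 - 1 / real n) ^ t \<le> exp (1 / real n - c)"
    using n by (simp add: mult_left_mono)
  then show ?thesis using tv_dist_one_sided_le[OF n, of t] by linarith
qed

section \<open>Untouched positions\<close>

text \<open>For the lower bound both entries of each transposition have to be remembered, which the
  permutation does not do when \<open>i = j\<close>.\<close>

definition draw :: "nat \<Rightarrow> (nat \<times> nat) pmf" where
  "draw n = pmf_of_set {1..n} \<bind> (\<lambda>j. map_pmf (\<lambda>i. (i, j)) (pmf_of_set {1..j}))"

lemma one_sided_shuffle_eq_map:
  assumes "n \<ge> 1"
  shows "one_sided_shuffle n = map_pmf (\<lambda>(i, j). Transposition.transpose i j) (draw n)"
  using assms
  by (simp add: one_sided_shuffle_eq_bind draw_def map_bind_pmf pmf.map_comp comp_def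
      swap_below_def[abs_def])

lemma pmf_draw:
  assumes "n \<ge> 1"
  shows "pmf (draw n) (i, j)
    = (if 1 \<le> i \<and> i \<le> j \<and> j \<le> n then 1 / (real n * real j) else 0)"
proof -
  have q: "pmf (map_pmf (\<lambda>i. (i, j')) (pmf_of_set {1..j'})) (i, j)
      = (if j' = j then (if 1 \<le> i \<and> i \<le> j then 1 / real j else 0) else 0)"
    if "j' \<in> {1..n}" for j'
  proof -
    have eq: "{1..j'} \<inter> (\<lambda>i. (i, j')) -` {(i, j)} = (if j' = j \<and> 1 \<le> i \<and> i \<le> j then {i} else {})"
      by auto
    have ne: "{1..j'} \<noteq> {}" using that by auto
    show ?thesis
      by (simp only: pmf_map measure_pmf_of_set[OF ne finite_atLeastAtMost] eq) simp
  qed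
  have "pmf (draw n) (i, j)
      = (\<Sum>j'\<in>{1..n}. pmf (map_pmf (\<lambda>i. (i, j')) (pmf_of_set {1..j'})) (i, j)) / real (card {1..n})"
    unfolding draw_def by (rule pmf_bind_pmf_of_set) (use assms in auto)
  also have "\<dots> = (\<Sum>j'\<in>{1..n}. if j' = j then (if 1 \<le> i \<and> i \<le> j then 1 / real j else 0) else 0) / n"
    by (simp only: q cong: sum.cong) simp
  finally show ?thesis by auto
qed

lemma set_draw:
  assumes "n \<ge> 1"
  shows "set_pmf (draw n) \<subseteq> {(i, j). 1 \<le> i \<and> i \<le> j \<and> j \<le> n}"
  using assms by (auto simp: set_pmf_iff pmf_draw split: if_splits)

definition avoiding :: "nat \<Rightarrow> (nat \<times> nat) set" where
  "avoiding k = {(i, j). i \<noteq> k \<and> j \<noteq> k}"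

text \<open>Given \<open>j\<close>, the position \<open>k\<close> is hit with probability \<open>1\<close> if \<open>j = k\<close> and \<open>1 / j \<le> 1 / k\<close> if
  \<open>j > k\<close>.  Averaging over \<open>j\<close> bounds the probability of a hit by
  \<open>1 / n + (n - k) / (n k) = 1 / k\<close>.\<close>

lemma prob_draw_avoiding_ge:
  assumes k: "1 \<le> k" "k \<le> n"
  shows "measure_pmf.prob (draw n) (avoiding k) \<ge> 1 - 1 / real k"
proof -
  let ?A = "(\<lambda>i. (i, k)) ` {1..k}" and ?B = "(\<lambda>j. (k, j)) ` {k<..n}"
  have n: "n \<ge> 1" using k by simp
  have "measure_pmf.prob (draw n) (- avoiding k) \<le> measure_pmf.prob (draw n) (?A \<union> ?B)"
  proof (rule measure_pmf.finite_measure_mono_AE)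
    show "AE x in draw n. x \<in> - avoiding k \<longrightarrow> x \<in> ?A \<union> ?B"
      using set_draw[OF n] by (fastforce simp: AE_measure_pmf_iff avoiding_def image_iff)
  qed simp
  also have "\<dots> = sum (pmf (draw n)) ?A + sum (pmf (draw n)) ?B"
    by (subst measure_measure_pmf_finite) (auto intro!: sum.union_disjoint)
  also have "sum (pmf (draw n)) ?A = (\<Sum>i\<in>{1..k}. 1 / (real n * real k))"
    by (subst sum.reindex) (auto simp: inj_on_def pmf_draw[OF n] k intro!: sum.cong)
  also have "\<dots> = 1 / real n" using k by simp
  also have "sum (pmf (draw n)) ?B = (\<Sum>j\<in>{k<..n}. 1 / (real n * real j))"
    using k by (subst sum.reindex) (auto simp: inj_on_def pmf_draw[OF n] intro!: sum.cong)
  also have "\<dots> \<le> (\<Sum>j\<in>{k<..n}. 1 / (real n * real k))"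
    using k by (intro sum_mono divide_left_mono mult_left_mono mult_pos_pos) auto
  also have "1 / real n + \<dots> = 1 / real k"
    using k by (simp add: of_nat_diff field_simps)
  finally have "measure_pmf.prob (draw n) (- avoiding k) \<le> 1 / real k" by simp
  then show ?thesis
    using measure_pmf.prob_compl[of "avoiding k" "draw n"] by (simp add: Compl_eq_Diff_UNIV)
qed

text \<open>If no draw could hit both positions, the two hits would be mutually exclusive and hence
  negatively correlated.  The last summand is the probability of the only draw, \<open>(k, l)\<close>, that
  hits both.\<close>

lemma prob_draw_avoiding_both_le:
  assumes kl: "1 \<le> k" "k < l" "l \<le> n"
  shows "measure_pmf.prob (draw n) (avoiding k \<inter> avoiding l)
    \<le> measure_pmf.prob (draw n) (avoiding k) * measure_pmf.prob (draw n) (avoiding l)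
      + 1 / (real n * real l)"
proof -
  let ?P = "measure_pmf.prob (draw n)"
  have n: "n \<ge> 1" using kl by simp
  have "?P (- (avoiding k \<union> avoiding l)) \<le> ?P {(k, l)}"
  proof (rule measure_pmf.finite_measure_mono_AE)
    show "AE x in draw n. x \<in> - (avoiding k \<union> avoiding l) \<longrightarrow> x \<in> {(k, l)}"
      using set_draw[OF n] kl by (fastforce simp: AE_measure_pmf_iff avoiding_def)
  qed simp
  also have "\<dots> = 1 / (real n * real l)"
    using kl n by (simp add: measure_pmf_single pmf_draw)
  finally have both: "1 - ?P (avoiding k \<union> avoiding l) \<le> 1 / (real n * real l)"
    using measure_pmf.prob_compl[of "avoiding k \<union> avoiding l" "draw n"]
    by (simp add: Compl_eq_Diff_UNIV)
  have union: "?P (avoiding k \<union> avoiding l)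
      = ?P (avoiding k) + ?P (avoiding l) - ?P (avoiding k \<inter> avoiding l)"
    by (rule measure_Un3) (auto simp: fmeasurable_def measure_pmf.emeasure_eq_measure)
  have "0 \<le> (1 - ?P (avoiding k)) * (1 - ?P (avoiding l))"
    by (intro mult_nonneg_nonneg) auto
  with both union show ?thesis by (simp add: algebra_simps)
qed

definition apply_draws :: "(nat \<times> nat) list \<Rightarrow> nat \<Rightarrow> nat" where
  "apply_draws xs = foldr (\<lambda>(i, j). (\<circ>) (Transposition.transpose i j)) xs id"

lemma conv_power_map:
  "conv_power (map_pmf (\<lambda>(i, j). Transposition.transpose i j) q) t
    = map_pmf apply_draws (replicate_pmf t q)"
proof (induction t)
  case (Suc t)
  then show ?case
    by (simp add: convolve_eq_bind bind_map_pmf map_bind_pmf pmf.map_comp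
        flip: map_pmf_def) (auto simp: apply_draws_def comp_def case_prod_beta intro!: bind_pmf_cong)
qed (simp add: apply_draws_def)

lemma apply_draws_avoiding:
  assumes "set xs \<subseteq> avoiding k"
  shows "apply_draws xs k = k"
  using assms
  by (induction xs) (auto simp: apply_draws_def avoiding_def transpose_apply_other)

section \<open>Lower bound by the second moment method\<close>

lemma tv_dist_ge_prob_diff:
  assumes supp: "set_pmf p \<subseteq> sym_group n" "set_pmf q \<subseteq> sym_group n"
  shows "measure_pmf.prob p A - measure_pmf.prob q A \<le> tv_dist n p q"
proof -
  let ?S = "sym_group n" and ?d = "\<lambda>\<sigma>. pmf p \<sigma> - pmf q \<sigma>"
  have prob: "measure_pmf.prob r A = (\<Sum>\<sigma>\<in>?S \<inter> A. pmf r \<sigma>)" if "set_pmf r \<subseteq> ?S" for r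
  proof -
    have "measure_pmf.prob r A = measure_pmf.prob r (?S \<inter> A)"
      using that by (intro measure_pmf.finite_measure_eq_AE) (auto simp: AE_measure_pmf_iff)
    also have "\<dots> = (\<Sum>\<sigma>\<in>?S \<inter> A. pmf r \<sigma>)"
      by (rule measure_measure_pmf_finite) (rule finite_Int[OF disjI1[OF finite_sym_group]])
    finally show ?thesis .
  qed
  have split: "(\<Sum>\<sigma>\<in>?S. f \<sigma>) = (\<Sum>\<sigma>\<in>?S \<inter> A. f \<sigma>) + (\<Sum>\<sigma>\<in>?S - A. f \<sigma>)"
    for f :: "(nat \<Rightarrow> nat) \<Rightarrow> real"
    by (rule sum.Int_Diff[OF finite_sym_group])
  have diff: "measure_pmf.prob p A - measure_pmf.prob q A = (\<Sum>\<sigma>\<in>?S \<inter> A. ?d \<sigma>)"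
    by (simp only: prob[OF supp(1)] prob[OF supp(2)] sum_subtractf)
  have "(\<Sum>\<sigma>\<in>?S. ?d \<sigma>) = 0"
    using sum_pmf_eq_1[OF finite_sym_group supp(1)] sum_pmf_eq_1[OF finite_sym_group supp(2)]
    by (simp add: sum_subtractf)
  then have diff': "measure_pmf.prob p A - measure_pmf.prob q A = - (\<Sum>\<sigma>\<in>?S - A. ?d \<sigma>)"
    using split[of ?d] diff by linarith
  have "(\<Sum>\<sigma>\<in>?S \<inter> A. ?d \<sigma>) \<le> (\<Sum>\<sigma>\<in>?S \<inter> A. \<bar>?d \<sigma>\<bar>)"
    by (intro sum_mono) simp
  moreover have "- (\<Sum>\<sigma>\<in>?S - A. ?d \<sigma>) \<le> (\<Sum>\<sigma>\<in>?S - A. \<bar>?d \<sigma>\<bar>)"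
    unfolding sum_negf[symmetric] by (intro sum_mono) simp
  ultimately show ?thesis
    using split[of "\<lambda>\<sigma>. \<bar>?d \<sigma>\<bar>"] diff diff' by (simp add: tv_dist_def)
qed

text \<open>This is the Cauchy--Schwarz bound \<open>P(N > 0) \<ge> (E N)\<^sup>2 / E N\<^sup>2\<close> for the number \<open>N\<close> of events
  that occur, in a form that needs only a lower bound \<open>g\<close> on the mean and near independence of
  pairs.\<close>

lemma second_moment_pmf:
  fixes M :: "'a pmf" and E :: "'b \<Rightarrow> 'a set" and g r :: real
  assumes V: "finite V" and g: "0 < g" "g \<le> (\<Sum>k\<in>V. measure_pmf.prob M (E k))" and r: "0 \<le> r"
    and pair: "\<And>k l. k \<in> V \<Longrightarrow> l \<in> V \<Longrightarrow> k \<noteq> l \<Longrightarrow>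
      measure_pmf.prob M (E k \<inter> E l) \<le> r * (measure_pmf.prob M (E k) * measure_pmf.prob M (E l))"
  shows "measure_pmf.prob M (\<Union>k\<in>V. E k) \<ge> 1 / (1 / g + r)"
proof -
  let ?P = "measure_pmf.prob M"
  define \<mu> where "\<mu> = (\<Sum>k\<in>V. ?P (E k))"
  define N :: "'a \<Rightarrow> real" where "N x = (\<Sum>k\<in>V. indicator (E k) x)" for x
  (* The indicator of N > 0 is at least 2 a N - a^2 N^2 = 1 - (1 - a N)^2 for every a; this value of a
     maximises the expectation of the right-hand side once E N^2 is replaced by its bound. *)
  define a where "a = 1 / (1 + r * \<mu>)"
  have \<mu>: "\<mu> > 0" "g \<le> \<mu>" using g by (simp_all add: \<mu>_def)
  have pos: "0 < 1 + r * \<mu>" using \<mu> r by (simp add: add_pos_nonneg)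
  have int: "integrable M (\<lambda>x. indicator A x :: real)" for A
    by (simp add: integrable_indicator_iff measure_pmf.emeasure_eq_measure)
  have N2: "(N x)\<^sup>2 = (\<Sum>k\<in>V. \<Sum>l\<in>V. indicator (E k \<inter> E l) x)" for x
    by (simp add: N_def power2_eq_square sum_product indicator_inter_arith)
  have EN: "integrable M N" "(\<integral>x. N x \<partial>M) = \<mu>"
    unfolding N_def \<mu>_def by (simp_all add: int)
  have EN2: "integrable M (\<lambda>x. (N x)\<^sup>2)"
      "(\<integral>x. (N x)\<^sup>2 \<partial>M) = (\<Sum>k\<in>V. \<Sum>l\<in>V. ?P (E k \<inter> E l))"
    unfolding N2 by (simp_all add: int)
  have "(\<Sum>l\<in>V. ?P (E k \<inter> E l)) \<le> ?P (E k) + r * (?P (E k) * \<mu>)" if k: "k \<in> V" for k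
  proof -
    have "(\<Sum>l\<in>V. ?P (E k \<inter> E l)) = ?P (E k) + (\<Sum>l\<in>V - {k}. ?P (E k \<inter> E l))"
      using V k by (simp add: sum.remove)
    also have "(\<Sum>l\<in>V - {k}. ?P (E k \<inter> E l)) \<le> (\<Sum>l\<in>V - {k}. r * (?P (E k) * ?P (E l)))"
      using k pair by (intro sum_mono) auto
    also have "\<dots> \<le> (\<Sum>l\<in>V. r * (?P (E k) * ?P (E l)))"
      using V r by (intro sum_mono2) auto
    finally show ?thesis by (simp add: \<mu>_def sum_distrib_left)
  qed
  then have "(\<integral>x. (N x)\<^sup>2 \<partial>M) \<le> (\<Sum>k\<in>V. ?P (E k) + r * (?P (E k) * \<mu>))"
    unfolding EN2 by (rule sum_mono)
  also have "\<dots> = \<mu> * (1 + r * \<mu>)"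
    by (simp add: sum.distrib \<mu>_def algebra_simps flip: sum_distrib_left sum_distrib_right)
  finally have second: "(\<integral>x. (N x)\<^sup>2 \<partial>M) \<le> \<mu> * (1 + r * \<mu>)" .
  have "1 / (1 / g + r) \<le> 1 / (1 / \<mu> + r)"
    using \<mu> g r by (intro divide_left_mono add_right_mono mult_pos_pos add_pos_nonneg) auto
  also have "\<dots> = a * \<mu>"
    using \<mu> pos by (simp add: a_def field_simps)
  also have "\<dots> = 2 * a * \<mu> - a\<^sup>2 * (\<mu> * (1 + r * \<mu>))"
    using pos by (simp add: a_def power2_eq_square)
  also have "\<dots> \<le> 2 * a * \<mu> - a\<^sup>2 * (\<integral>x. (N x)\<^sup>2 \<partial>M)"
    using second by (intro diff_left_mono mult_left_mono) auto
  also have "\<dots> = (\<integral>x. 2 * a * N x - a\<^sup>2 * (N x)\<^sup>2 \<partial>M)"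
    using EN EN2 by simp
  also have "\<dots> \<le> (\<integral>x. indicator (\<Union>k\<in>V. E k) x \<partial>M)"
  proof (rule integral_mono)
    fix x
    show "2 * a * N x - a\<^sup>2 * (N x)\<^sup>2 \<le> indicator (\<Union>k\<in>V. E k) x"
    proof (cases "x \<in> (\<Union>k\<in>V. E k)")
      case True
      have "0 \<le> (1 - a * N x)\<^sup>2" by simp
      with True show ?thesis by (simp add: power2_eq_square algebra_simps)
    next
      case False
      then have "N x = 0" by (simp add: N_def)
      with False show ?thesis by simp
    qed
  qed (use EN EN2 int in auto)
  finally show ?thesis by simp
qed

lemma prob_uniform_perm_fixed:
  assumes "1 \<le> k" "k \<le> n"
  shows "measure_pmf.prob (uniform_perm n) {\<sigma>. \<sigma> k = k} = 1 / real n"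
proof -
  have "sym_group n \<inter> {\<sigma>. \<sigma> k = k} = {\<sigma>. \<sigma> permutes ({1..n} - {k})}"
  proof (intro equalityI subsetI)
    fix \<sigma> assume "\<sigma> \<in> sym_group n \<inter> {\<sigma>. \<sigma> k = k}"
    then show "\<sigma> \<in> {\<sigma>. \<sigma> permutes ({1..n} - {k})}"
      by (auto elim: permutes_superset)
  next
    fix \<sigma> assume "\<sigma> \<in> {\<sigma>. \<sigma> permutes ({1..n} - {k})}"
    then show "\<sigma> \<in> sym_group n \<inter> {\<sigma>. \<sigma> k = k}"
      using permutes_not_in[of \<sigma> "{1..n} - {k}" k] by (auto intro: permutes_subset)
  qed
  moreover have "card {\<sigma>. \<sigma> permutes ({1..n} - {k})} = fact (n - 1)"
    using assms by (intro card_permutations) auto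
  moreover have "(fact n :: real) = real n * fact (n - 1)"
    using assms by (subst fact_reduce) auto
  ultimately show ?thesis
    unfolding uniform_perm_def measure_pmf_of_set[OF sym_group_not_empty finite_sym_group]
    using assms by (simp only: card_sym_group of_nat_fact) simp
qed

lemma power_ge_exp:
  assumes b: "b \<ge> 1" and a: "1 - 1 / real (Suc b) \<le> a"
  shows "exp (- (real t / real b)) \<le> a ^ t"
proof -
  have "1 + 1 / real b \<le> exp (1 / real b)" by (rule exp_ge_add_one_self)
  then have "exp (- (1 / real b)) \<le> 1 / (1 + 1 / real b)"
    unfolding exp_minus divide_inverse mult_1 by (rule le_imp_inverse_le) (use b in \<open>simp add: add_pos_nonneg\<close>)
  also have "\<dots> = 1 - 1 / real (Suc b)" using b by (simp add: field_simps)
  also have "\<dots> \<le> a" by (rule a)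
  finally have "exp (- (1 / real b)) ^ t \<le> a ^ t" by (intro power_mono) auto
  then show ?thesis by (simp flip: exp_of_nat_mult)
qed

text \<open>The two laws are compared on the set of permutations with a fixed point above \<open>b\<close>.  The first fraction is the second moment bound for the positions above \<open>b\<close>
  that no draw has hit, where the last exponential bounds the excess correlation of pairs; the
  subtracted term bounds the probability under the uniform distribution.\<close>

lemma tv_dist_one_sided_ge:
  assumes b: "1 \<le> b" "b < n"
  shows "1 / (1 / ((real n - real b) * exp (- (real t / real b)))
        + exp (real t * (real b + 1) / (real n * (real b)\<^sup>2))) - (real n - real b) / real n
    \<le> tv_dist n (conv_power (one_sided_shuffle n) t) (uniform_perm n)"
proof -
  define R where "R = replicate_pmf t (draw n)"
  define V where "V = {b<..n}"
  define E where "E k = {xs. set xs \<subseteq> avoiding k}" for k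
  define A where "A = (\<Union>k\<in>V. {\<sigma>. \<sigma> k = k} :: (nat \<Rightarrow> nat) set)"
  define r where "r = (real b + 1) / (real n * (real b)\<^sup>2)"
  define s where "s k = measure_pmf.prob (draw n) (avoiding k)" for k
  have n: "n \<ge> 1" using b by simp
  have cardV: "real (card V) = real n - real b" using b by (simp add: V_def of_nat_diff)
  have Vn: "1 \<le> k" "k \<le> n" "b < k" if "k \<in> V" for k using that b by (auto simp: V_def)
  have probE: "measure_pmf.prob R (E k) = s k ^ t" for k
    by (simp add: R_def E_def s_def prob_replicate_pmf_all)
  have s: "1 - 1 / real (Suc b) \<le> s k" if "k \<in> V" for k
  proof -
    have "1 - 1 / real (Suc b) \<le> 1 - 1 / real k"
      using Vn[OF that] by (intro diff_left_mono divide_left_mono) auto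
    also have "\<dots> \<le> s k" unfolding s_def by (rule prob_draw_avoiding_ge) (use Vn[OF that] in auto)
    finally show ?thesis .
  qed
  have pair_less: "measure_pmf.prob R (E k \<inter> E l) \<le> exp (real t * r) * (s k ^ t * s l ^ t)"
    if kl: "k \<in> V" "l \<in> V" "k < l" for k l
  proof -
    have "E k \<inter> E l = {xs. set xs \<subseteq> avoiding k \<inter> avoiding l}" by (auto simp: E_def)
    then have "measure_pmf.prob R (E k \<inter> E l)
        = measure_pmf.prob (draw n) (avoiding k \<inter> avoiding l) ^ t"
      by (simp only: R_def prob_replicate_pmf_all)
    also have "\<dots> \<le> (exp r * (s k * s l)) ^ t"
    proof (rule power_mono)
      have "measure_pmf.prob (draw n) (avoiding k \<inter> avoiding l) \<le> s k * s l + 1 / (real n * real l)"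
        unfolding s_def by (rule prob_draw_avoiding_both_le) (use Vn kl in auto)
      also have "1 / (real n * real l) \<le> 1 / (real n * real (Suc b))"
        using Vn[OF kl(2)] b by (intro divide_left_mono mult_left_mono mult_pos_pos) auto
      also have "\<dots> = r * ((1 - 1 / real (Suc b)) * (1 - 1 / real (Suc b)))"
        using b by (simp add: r_def divide_simps power2_eq_square)
      also have "\<dots> \<le> r * (s k * s l)"
        using s[OF kl(1)] s[OF kl(2)] by (intro mult_left_mono mult_mono) (auto simp: r_def s_def)
      also have "s k * s l + r * (s k * s l) = (1 + r) * (s k * s l)"
        by (simp add: algebra_simps)
      also have "\<dots> \<le> exp r * (s k * s l)"
        by (intro mult_right_mono exp_ge_add_one_self) (auto simp: s_def)
      finally show "measure_pmf.prob (draw n) (avoiding k \<inter> avoiding l) \<le> exp r * (s k * s l)"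
        by simp
    qed simp
    also have "\<dots> = exp (real t * r) * (s k ^ t * s l ^ t)"
      by (simp add: power_mult_distrib exp_of_nat_mult)
    finally show ?thesis .
  qed
  have pair: "measure_pmf.prob R (E k \<inter> E l)
      \<le> exp (real t * r) * (measure_pmf.prob R (E k) * measure_pmf.prob R (E l))"
    if "k \<in> V" "l \<in> V" "k \<noteq> l" for k l
    using that pair_less[of k l] pair_less[of l k]
    by (cases k l rule: linorder_cases) (auto simp: probE Int_commute mult.commute)
  have "(real n - real b) * exp (- (real t / real b)) = (\<Sum>k\<in>V. exp (- (real t / real b)))"
    by (simp add: cardV)
  also have "\<dots> \<le> (\<Sum>k\<in>V. measure_pmf.prob R (E k))"
    unfolding probE using s b by (intro sum_mono power_ge_exp) auto
  finally have "1 / (1 / ((real n - real b) * exp (- (real t / real b))) + exp (real t * r))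
      \<le> measure_pmf.prob R (\<Union>k\<in>V. E k)"
    using b pair by (intro second_moment_pmf) (auto simp: V_def)
  also have "\<dots> \<le> measure_pmf.prob R (apply_draws -` A)"
    by (intro measure_pmf.finite_measure_mono) (auto simp: A_def E_def dest!: apply_draws_avoiding)
  also have "\<dots> = measure_pmf.prob (conv_power (one_sided_shuffle n) t) A"
    by (simp add: R_def one_sided_shuffle_eq_map[OF n] conv_power_map)
  finally have walk: "1 / (1 / ((real n - real b) * exp (- (real t / real b))) + exp (real t * r))
      \<le> measure_pmf.prob (conv_power (one_sided_shuffle n) t) A" .
  have "measure_pmf.prob (uniform_perm n) A
      \<le> (\<Sum>k\<in>V. measure_pmf.prob (uniform_perm n) {\<sigma>. \<sigma> k = k})"
    unfolding A_def by (intro measure_pmf.finite_measure_subadditive_finite) (auto simp: V_def)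
  also have "\<dots> = (\<Sum>k\<in>V. 1 / real n)"
    using Vn by (intro sum.cong refl prob_uniform_perm_fixed) auto
  also have "\<dots> = (real n - real b) / real n" by (simp add: cardV)
  finally have unif: "measure_pmf.prob (uniform_perm n) A \<le> (real n - real b) / real n" .
  have "measure_pmf.prob (conv_power (one_sided_shuffle n) t) A
      - measure_pmf.prob (uniform_perm n) A
    \<le> tv_dist n (conv_power (one_sided_shuffle n) t) (uniform_perm n)"
    by (intro tv_dist_ge_prob_diff set_conv_power set_one_sided_shuffle n)
       (simp add: set_uniform_perm)
  with walk unif show ?thesis by (simp add: r_def)
qed

section \<open>Asymptotics\<close>

lemma floor_quotient_estimates:
  fixes n v :: nat and L :: real
  assumes L: "1 < L" and n: "L \<le> real n" and v: "v = nat \<lfloor>real n / L\<rfloor>"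
  shows "1 \<le> v" "v < n" "real n / L - 1 \<le> real v" "real v \<le> real n / L"
    "real n * (L - 1) / L \<le> real n - real v"
proof -
  have "1 \<le> real n / L" using L n by simp
  then have "real v = of_int \<lfloor>real n / L\<rfloor>" unfolding v by simp
  then show lo: "real n / L - 1 \<le> real v" and hi: "real v \<le> real n / L" by linarith+
  show "1 \<le> v" using \<open>1 \<le> real n / L\<close> unfolding v by (simp add: le_nat_iff)
  have "real n / L < real n" using L n by (simp add: field_simps)
  with hi show "v < n" by linarith
  have "real n * (L - 1) / L = real n - real n / L" using L by (simp add: field_simps)
  with hi show "real n * (L - 1) / L \<le> real n - real v" by linarith
qed

text \<open>The bound of \<open>tv_dist_one_sided_ge\<close> at time \<open>n log n - n log log n - c n\<close> with
  \<open>n - b \<approx> n / log n\<close>, expressed through \<open>L = log n\<close>.  The size \<open>n / log n\<close> balances two errors: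
  it makes uniform fixed points rare, and the extra chance of being hit as the lower entry costs the
  mean number of untouched positions only the bounded factor \<open>1/e\<close>.\<close>

definition lower_bound_at :: "real \<Rightarrow> real \<Rightarrow> real" where
  "lower_bound_at c L
    = 1 / (1 / ((exp L / L - 1) * exp (- ((L - ln L - c) * (L / (L - 1)))))
           + exp (2 * L\<^sup>2 / (exp L * (L - 1)))) - 1 / L"

lemma tendsto_lower_bound_at:
  "(lower_bound_at c \<longlongrightarrow> 1 / (exp (1 - c) + 1)) at_top"
proof -
  have "((\<lambda>L. (exp L / L - 1) * exp (- ((L - ln L - c) * (L / (L - 1))))) \<longlongrightarrow> exp (c - 1)) at_top"
    by real_asymp
  moreover have "((\<lambda>L::real. exp (2 * L\<^sup>2 / (exp L * (L - 1)))) \<longlongrightarrow> 1) at_top"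
    by real_asymp
  moreover have "((\<lambda>L::real. 1 / L) \<longlongrightarrow> 0) at_top"
    by real_asymp
  moreover have "1 / exp (c - 1) + 1 \<noteq> 0"
    by (simp add: add_nonneg_eq_0_iff)
  ultimately have "(lower_bound_at c \<longlongrightarrow> 1 / (1 / exp (c - 1) + 1) - 0) at_top"
    unfolding lower_bound_at_def[abs_def] by (intro tendsto_intros) auto
  moreover have "1 / exp (c - 1) = exp (1 - c)"
    by (simp add: exp_diff)
  ultimately show ?thesis by simp
qed

lemma tv_dist_one_sided_ge_lower_bound_at:
  fixes n t :: nat and c :: real
  assumes L: "L = ln (real n)" "1 < L" "0 \<le> ln L + c" "L < exp L / 2"
    and t: "real t \<le> real n * L - real n * ln L - c * real n"
  shows "lower_bound_at c L \<le> tv_dist n (conv_power (one_sided_shuffle n) t) (uniform_perm n)"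
proof -
  have n: "n \<ge> 1" using L(1,2) by (cases n) auto
  have expL: "exp L = real n" using n by (simp add: L(1))
  define v where "v = nat \<lfloor>real n / L\<rfloor>"
  define b where "b = n - v"
  have "L \<le> real n" using L(2,4) expL by linarith
  note v = floor_quotient_estimates[OF L(2) this v_def]
  have b: "1 \<le> b" "b < n" using v(1,2) by (simp_all add: b_def)
  have vb: "real n - real b = real v" using v(2) by (simp add: b_def of_nat_diff)
  have b_ge: "real n * (L - 1) / L \<le> real b" using v(5) vb by linarith
  have pos: "0 < real n * (L - 1) / L" using n L(2) by simp
  have t': "real t \<le> real n * (L - ln L - c)" using t by (simp add: algebra_simps)
  have nonneg: "0 \<le> L - ln L - c"
    using order_trans[OF of_nat_0_le_iff t'] n by (simp add: zero_le_mult_iff)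
  have "real t / real b \<le> (real n * (L - ln L - c)) / (real n * (L - 1) / L)"
    using t' b_ge pos nonneg by (intro frac_le) auto
  also have "\<dots> = (L - ln L - c) * (L / (L - 1))" using n L(2) by (simp add: field_simps)
  finally have tb: "real t / real b \<le> (L - ln L - c) * (L / (L - 1))" .
  have "real t * (real b + 1) / (real n * (real b)\<^sup>2) = real t / real n * ((real b + 1) / (real b)\<^sup>2)"
    by simp
  also have "\<dots> \<le> L * (2 / real b)"
  proof (rule mult_mono)
    have "real n * (L - ln L - c) \<le> real n * L"
      using L(3) by (intro mult_left_mono) auto
    then have "real t \<le> L * real n" using t' by (simp add: mult.commute)
    then show "real t / real n \<le> L" using n by (simp add: divide_le_eq)
    show "(real b + 1) / (real b)\<^sup>2 \<le> 2 / real b"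
      using b by (simp add: field_simps power2_eq_square)
  qed (use L b in auto)
  also have "\<dots> \<le> L * (2 / (real n * (L - 1) / L))"
    using b_ge pos L(2) by (intro mult_left_mono divide_left_mono mult_pos_pos) auto
  also have "\<dots> = 2 * L\<^sup>2 / (exp L * (L - 1))"
    using L(2) by (simp add: expL power2_eq_square)
  finally have corr: "real t * (real b + 1) / (real n * (real b)\<^sup>2) \<le> 2 * L\<^sup>2 / (exp L * (L - 1))" .
  have g_pos: "0 < exp L / L - 1" using L(2,4) by (simp add: field_simps)
  have g: "(exp L / L - 1) * exp (- ((L - ln L - c) * (L / (L - 1))))
      \<le> (real n - real b) * exp (- (real t / real b))"
    using v(3) tb g_pos by (intro mult_mono) (auto simp: expL vb)
  have "lower_bound_at c L
      \<le> 1 / (1 / ((real n - real b) * exp (- (real t / real b)))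
          + exp (real t * (real b + 1) / (real n * (real b)\<^sup>2))) - (real n - real b) / real n"
  proof -
    have "(real n - real b) / real n \<le> 1 / L"
      using v(4) n L(2) by (simp add: vb field_simps)
    moreover have "1 / ((real n - real b) * exp (- (real t / real b)))
        \<le> 1 / ((exp L / L - 1) * exp (- ((L - ln L - c) * (L / (L - 1)))))"
      using g_pos b by (intro divide_left_mono g mult_pos_pos) auto
    then have "1 / (1 / ((exp L / L - 1) * exp (- ((L - ln L - c) * (L / (L - 1)))))
           + exp (2 * L\<^sup>2 / (exp L * (L - 1))))
      \<le> 1 / (1 / ((real n - real b) * exp (- (real t / real b)))
          + exp (real t * (real b + 1) / (real n * (real b)\<^sup>2)))"
      using corr b g_pos g
      by (intro divide_left_mono add_mono mult_pos_pos add_nonneg_pos) auto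
    ultimately show ?thesis unfolding lower_bound_at_def by linarith
  qed
  also have "\<dots> \<le> tv_dist n (conv_power (one_sided_shuffle n) t) (uniform_perm n)"
    by (rule tv_dist_one_sided_ge[OF b])
  finally show ?thesis .
qed

text \<open>An upper bound on the times suffices, so the statement covers both the specific time of the
  theorem and every time \<open>n log n - c' n log log n\<close> with \<open>c' > 1\<close>.\<close>

lemma liminf_dist_at_ge:
  fixes T :: "nat \<Rightarrow> real"
  assumes pos: "\<forall>\<^sub>F n in sequentially. 0 \<le> T n"
    and le: "\<forall>\<^sub>F n in sequentially.
      T n \<le> real n * ln (real n) - real n * ln (ln (real n)) - c * real n"
  shows "ereal (1 / (exp (1 - c) + 1)) \<le> liminf (\<lambda>n. ereal (dist_at one_sided_shuffle n (T n)))"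
proof -
  have "(\<lambda>n. lower_bound_at c (ln (real n))) \<longlonglongrightarrow> 1 / (exp (1 - c) + 1)"
    by (rule filterlim_compose[OF tendsto_lower_bound_at]) real_asymp
  then have "ereal (1 / (exp (1 - c) + 1)) = liminf (\<lambda>n. ereal (lower_bound_at c (ln (real n))))"
    by (intro lim_imp_Liminf[symmetric]) auto
  also have "\<dots> \<le> liminf (\<lambda>n. ereal (dist_at one_sided_shuffle n (T n)))"
  proof (rule Liminf_mono)
    have "\<forall>\<^sub>F n in sequentially. 1 < ln (real n)"
      "\<forall>\<^sub>F n in sequentially. 0 \<le> ln (ln (real n)) + c"
      "\<forall>\<^sub>F n in sequentially. ln (real n) < exp (ln (real n)) / 2" by real_asymp+
    with pos le show "\<forall>\<^sub>F n in sequentially.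
      ereal (lower_bound_at c (ln (real n))) \<le> ereal (dist_at one_sided_shuffle n (T n))"
    proof eventually_elim
      case (elim n)
      then have "real (nat \<lfloor>T n\<rfloor>) \<le> T n" by simp
      with elim show ?case unfolding dist_at_def
        by (simp add: tv_dist_one_sided_ge_lower_bound_at)
    qed
  qed
  finally show ?thesis .
qed

text \<open>Letting \<open>c\<close> depend on \<open>n\<close> covers both a constant shift and a shift by a multiple of
  \<open>log log n\<close>.\<close>

lemma limsup_dist_at_le:
  fixes c :: "nat \<Rightarrow> real"
  assumes lim: "(\<lambda>n. exp (1 / real n - c n)) \<longlonglongrightarrow> e"
    and T: "\<And>n. T n = real n * ln (real n) + c n * real n"
  shows "limsup (\<lambda>n. ereal (dist_at one_sided_shuffle n (T n))) \<le> ereal e"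
proof -
  have "limsup (\<lambda>n. ereal (dist_at one_sided_shuffle n (T n)))
      \<le> limsup (\<lambda>n. ereal (exp (1 / real n - c n)))"
  proof (rule Limsup_mono)
    show "\<forall>\<^sub>F n in sequentially.
        ereal (dist_at one_sided_shuffle n (T n)) \<le> ereal (exp (1 / real n - c n))"
      using eventually_ge_at_top[of 1]
    proof eventually_elim
      case (elim n)
      have "T n - 1 \<le> real (nat \<lfloor>T n\<rfloor>)" by linarith
      then show ?case
        unfolding dist_at_def using elim by (simp add: T tv_dist_one_sided_le_exp)
    qed
  qed
  also have "\<dots> = ereal e"
    using lim by (intro lim_imp_Limsup) auto
  finally show ?thesis .
qed

lemma tv_dist_nonneg: "0 \<le> tv_dist n p q"
  by (simp add: tv_dist_def sum_nonneg)

lemma dist_at_one_sided_le_1: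
  assumes "n \<ge> 1"
  shows "dist_at one_sided_shuffle n x \<le> 1"
  unfolding dist_at_def
  by (rule tv_dist_le_of_domination[OF set_conv_power[OF set_one_sided_shuffle[OF assms]]])
     (simp_all add: set_uniform_perm)

lemma cutoff_one_sided_shuffle:
  "cutoff_window one_sided_shuffle (\<lambda>n. real n * ln (real n)) (\<lambda>n. real n * ln (ln (real n)))"
  unfolding cutoff_window_def
proof (intro conjI allI impI)
  let ?t = "\<lambda>n. real n * ln (real n)" and ?w = "\<lambda>n. real n * ln (ln (real n))"
  let ?d = "dist_at one_sided_shuffle"
  show "set_pmf (one_sided_shuffle n) \<subseteq> sym_group n" if "n \<ge> 1" for n
    using that by (rule set_one_sided_shuffle)
  show "?w \<in> o(?t)" by real_asymp
  have up: "limsup (\<lambda>n. ereal (?d n (?t n + c * ?w n))) = 0" if "c > 0" for c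
  proof (rule antisym)
    have "limsup (\<lambda>n. ereal (?d n (?t n + c * ?w n))) \<le> ereal 0"
    proof (rule limsup_dist_at_le)
      show "(\<lambda>n. exp (1 / real n - c * ln (ln (real n)))) \<longlonglongrightarrow> 0"
        using that by real_asymp
    qed (simp add: algebra_simps)
    then show "limsup (\<lambda>n. ereal (?d n (?t n + c * ?w n))) \<le> 0"
      by (simp only: zero_ereal_def)
    show "0 \<le> limsup (\<lambda>n. ereal (?d n (?t n + c * ?w n)))"
      by (rule le_Limsup) (auto simp: dist_at_def tv_dist_nonneg)
  qed
  show "((\<lambda>c::real. limsup (\<lambda>n. ereal (?d n (?t n + c * ?w n)))) \<longlongrightarrow> 0) at_top"
    by (rule tendsto_eventually) (rule eventually_mono[OF eventually_gt_at_top[of 0] up])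
  have low: "liminf (\<lambda>n. ereal (?d n (?t n - c * ?w n))) = 1" if "c > 1" for c
  proof (rule antisym)
    have "liminf (\<lambda>n. ereal (?d n (?t n - c * ?w n))) \<le> limsup (\<lambda>n. ereal (?d n (?t n - c * ?w n)))"
      by (rule Liminf_le_Limsup) simp
    also have "\<dots> \<le> 1"
      by (rule Limsup_bounded)
         (use eventually_ge_at_top[of 1] in \<open>eventually_elim, simp add: dist_at_one_sided_le_1\<close>)
    finally show "liminf (\<lambda>n. ereal (?d n (?t n - c * ?w n))) \<le> 1" .
    (* For c > 1 the shift c n log log n eventually exceeds n log log n + d n for every d. *)
    have "ereal (1 / (exp (1 - d) + 1)) \<le> liminf (\<lambda>n. ereal (?d n (?t n - c * ?w n)))" for d
    proof (rule liminf_dist_at_ge)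
      show "\<forall>\<^sub>F n in sequentially. 0 \<le> ?t n - c * ?w n" by real_asymp
      show "\<forall>\<^sub>F n in sequentially. ?t n - c * ?w n \<le> ?t n - ?w n - d * real n"
        using that by real_asymp
    qed
    then have bound: "\<forall>\<^sub>F d in at_top. ereal (1 / (exp (1 - d) + 1))
        \<le> liminf (\<lambda>n. ereal (?d n (?t n - c * ?w n)))"
      by (rule always_eventually[OF allI])
    have lim: "((\<lambda>d::real. ereal (1 / (exp (1 - d) + 1))) \<longlongrightarrow> ereal 1) at_top"
      unfolding lim_ereal by real_asymp
    have "ereal 1 \<le> liminf (\<lambda>n. ereal (?d n (?t n - c * ?w n)))"
      by (rule tendsto_upperbound[OF lim bound]) simp
    then show "1 \<le> liminf (\<lambda>n. ereal (?d n (?t n - c * ?w n)))"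
      by (simp only: one_ereal_def)
  qed
  show "((\<lambda>c::real. liminf (\<lambda>n. ereal (?d n (?t n - c * ?w n)))) \<longlongrightarrow> 1) at_top"
    by (rule tendsto_eventually) (rule eventually_mono[OF eventually_gt_at_top[of 1] low])
qed

lemma logistic_ge_quadratic:
  fixes c :: real
  assumes "c > 2"
  shows "1 - pi\<^sup>2 / (6 * (c - 2)\<^sup>2) \<le> 1 / (exp (1 - c) + 1)"
proof -
  define x where "x = c - 2"
  have x: "x > 0" using assms by (simp add: x_def)
  have "x\<^sup>2 / 2 \<le> exp x" using exp_lower_Taylor_quadratic[of x] x by linarith
  then have "x\<^sup>2 / 2 * 2 \<le> exp x * exp 1"
    using exp_ge_add_one_self[of 1] x by (intro mult_mono) auto
  then have "x\<^sup>2 \<le> exp (x + 1)" by (simp add: exp_add)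
  have "1 - 1 / (y + 1) \<le> y" if "y > 0" for y :: real
    using that by (simp add: field_simps)
  from this[of "exp (1 - c)"] have "1 - 1 / (exp (1 - c) + 1) \<le> exp (1 - c)" by simp
  also have "\<dots> = 1 / exp (x + 1)" by (simp add: x_def exp_minus[symmetric] flip: exp_minus inverse_eq_divide)
  also have "\<dots> \<le> 1 / x\<^sup>2" using \<open>x\<^sup>2 \<le> exp (x + 1)\<close> x by (intro divide_left_mono) auto
  also have "\<dots> = 6 / (6 * x\<^sup>2)" by simp
  also have "\<dots> \<le> pi\<^sup>2 / (6 * x\<^sup>2)"
  proof (rule divide_right_mono)
    have "3\<^sup>2 \<le> pi\<^sup>2" using pi_gt3 by (intro power_mono) auto
    then show "6 \<le> pi\<^sup>2" by simp
  qed simp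
  finally show ?thesis by (simp add: x_def)
qed

theorem theorem3:
  shows "cutoff one_sided_shuffle (\<lambda>n. real n * ln (real n))
    \<and> (\<forall>c1::real. c1 > 0 \<longrightarrow>
         limsup (\<lambda>n. ereal (dist_at one_sided_shuffle n
           (real n * ln (real n) + c1 * real n)))
         \<le> ereal (sqrt 2 * exp (- c1)))
    \<and> (\<forall>c2::real. c2 > 2 \<longrightarrow>
         liminf (\<lambda>n. ereal (dist_at one_sided_shuffle n
           (real n * ln (real n) - real n * ln (ln (real n)) - c2 * real n)))
         \<ge> ereal (1 - pi\<^sup>2 / (6 * (c2 - 2)\<^sup>2)))"
proof (intro conjI allI impI)
  show "cutoff one_sided_shuffle (\<lambda>n. real n * ln (real n))"
    unfolding cutoff_def using cutoff_one_sided_shuffle by blast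
next
  fix c1 :: real
  assume "c1 > 0"
  have "limsup (\<lambda>n. ereal (dist_at one_sided_shuffle n (real n * ln (real n) + c1 * real n)))
      \<le> ereal (exp (- c1))"
    by (rule limsup_dist_at_le[where c = "\<lambda>_. c1"]) (real_asymp | simp)+
  also have "\<dots> \<le> ereal (sqrt 2 * exp (- c1))" by simp
  finally show "limsup (\<lambda>n. ereal (dist_at one_sided_shuffle n
      (real n * ln (real n) + c1 * real n))) \<le> ereal (sqrt 2 * exp (- c1))" .
next
  fix c2 :: real
  assume c2: "c2 > 2"
  have "ereal (1 - pi\<^sup>2 / (6 * (c2 - 2)\<^sup>2)) \<le> ereal (1 / (exp (1 - c2) + 1))"
    using logistic_ge_quadratic[OF c2] by simp
  also have "\<dots> \<le> liminf (\<lambda>n. ereal (dist_at one_sided_shuffle n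
      (real n * ln (real n) - real n * ln (ln (real n)) - c2 * real n)))"
  proof (rule liminf_dist_at_ge)
    show "\<forall>\<^sub>F n in sequentially.
        0 \<le> real n * ln (real n) - real n * ln (ln (real n)) - c2 * real n"
      by real_asymp
  qed simp
  finally show "ereal (1 - pi\<^sup>2 / (6 * (c2 - 2)\<^sup>2)) \<le> liminf (\<lambda>n. ereal (dist_at one_sided_shuffle n
      (real n * ln (real n) - real n * ln (ln (real n)) - c2 * real n)))" .
qed

end
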